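(* Let $G(u)=\sum_P x^{\mathrm{sper}(P)}u^{\mathrm{first}(P)}$, summed over all Stanley polyominoes $P$, and let \[ r=\frac{1+x-x^{2}-\sqrt{x^{4}-2x^{3}-x^{2}-2x+1}}{2x},\qquad s=\frac{1+x-x^{2}+\sqrt{x^{4}-2x^{3}-x^{2}-2x+1}}{2x}. \] Then \[ G(u)=\frac{xu}{r(s-u)}=\frac{\left(x^{2}u-xu-u+2-\sqrt{x^{4}-2x^{3}-x^{2}-2x+1}\,u\right)x^2u}{2\left(u^{2}x+x^{2}u-xu-u+1\right)}. \] Moreover, $[u^k]G(u)=x^2(rx)^{k-1}$, and for $k\geq 2$ and $n\geq k+1$, \[ [x^nu^k]G(u)=\sum_{j=0}^{n-k-1}\frac{k-1}{2j+k-1}\binom{2j+k-1}{j}(-1)^{n-k-1-j}\sum_{b=0}^{\left\lfloor\frac{n-k-1-j}{2}\right\rfloor}\binom{n+j-b-3}{n-k-1-j-b}\binom{n-k-1-j-b}{b}. \]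
   Context: Cells are unit squares $[i,i+1]\times[j,j+1]$ with $i,j\in\mathbb{Z}$. A Stanley polyomino (up to translation) is a set of cells forming $k\geq 1$ rows $0,\dots,k-1$ (bottom to top), row $j$ consisting of the cells with $s_j\le i\le e_j$ ($s_j\le e_j$ integers), such that $s_{j-1}<s_j\le e_{j-1}<e_j$ for $1\le j\le k-1$. The semiperimeter is $\mathrm{sper}(P)=\mathrm{col}(P)+\mathrm{row}(P)$, where $\mathrm{col}(P)=e_{k-1}-s_0+1$ is the number of columns and $\mathrm{row}(P)=k$ the number of rows; $\mathrm{first}(P)=e_0-s_0+1$ is the number of cells in the first (bottom) row. *)

theory Defs
  imports "HOL-Computational_Algebra.Computational_Algebra"
begin

section \<open>Stanley polyominoes\<close>

text \<open>The cell \<open>[i, i + 1] \<times> [j, j + 1]\<close> is the pair \<open>(i, j)\<close>: column \<open>i\<close>, row \<open>j\<close>.\<close>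

type_synonym cell = "int \<times> int"

definition stanley_rows :: "nat \<Rightarrow> (nat \<Rightarrow> int) \<Rightarrow> (nat \<Rightarrow> int) \<Rightarrow> bool" where
  "stanley_rows k s e \<longleftrightarrow> k \<ge> 1 \<and> (\<forall>j<k. s j \<le> e j) \<and>
     (\<forall>j. 1 \<le> j \<and> j \<le> k - 1 \<longrightarrow> s (j - 1) < s j \<and> s j \<le> e (j - 1) \<and> e (j - 1) < e j)"

definition cells_of_rows :: "nat \<Rightarrow> (nat \<Rightarrow> int) \<Rightarrow> (nat \<Rightarrow> int) \<Rightarrow> cell set" where
  "cells_of_rows k s e = {(i, int j) | i j. j < k \<and> s j \<le> i \<and> i \<le> e j}"

definition stanley_polyomino :: "cell set \<Rightarrow> bool" where
  "stanley_polyomino P \<longleftrightarrow> (\<exists>k s e. stanley_rows k s e \<and> P = cells_of_rows k s e)"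

definition translation :: "(cell set \<times> cell set) set" where
  "translation = {(P, Q). \<exists>a b. Q = (\<lambda>(i, j). (i + a, j + b)) ` P}"

definition col :: "cell set \<Rightarrow> nat" where
  "col P = card (fst ` P)"

definition row :: "cell set \<Rightarrow> nat" where
  "row P = card (snd ` P)"

definition sper :: "cell set \<Rightarrow> nat" where
  "sper P = col P + row P"

text \<open>The bottom row of a Stanley polyomino has index 0.\<close>

definition first_row :: "cell set \<Rightarrow> nat" where
  "first_row P = card {i. (i, 0) \<in> P}"

text \<open>The polyominoes, up to translation, with semiperimeter \<open>n\<close> and \<open>k\<close> cells in the first row.\<close>

definition stanley_classes :: "nat \<Rightarrow> nat \<Rightarrow> cell set set set" where
  "stanley_classes n k =
     {P. stanley_polyomino P \<and> sper P = n \<and> first_row P = k} // translation"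

subsection \<open>The statistics in terms of the row end points\<close>

lemma stanley_rows_mono:
  assumes "stanley_rows k s e" "i \<le> j" "j < k"
  shows "s i \<le> s j \<and> e i \<le> e j"
  using assms(2,3)
proof (induction j)
  case (Suc j)
  have "s j < s (Suc j) \<and> e j < e (Suc j)"
    using assms(1) Suc.prems(2) unfolding stanley_rows_def
    by (metis (no_types, lifting) One_nat_def Suc_le_mono Suc_pred diff_Suc_1 le0 less_Suc_eq_le
        less_imp_Suc_add zero_less_Suc)
  with Suc show ?case
    by (cases "i = Suc j") auto
qed auto

lemma fst_cells_of_rows:
  assumes "stanley_rows k s e"
  shows "fst ` cells_of_rows k s e = {s 0..e (k - 1)}"
proof -
  have k: "k \<ge> 1"
    using assms by (simp add: stanley_rows_def)
  have cover: "\<exists>l\<le>j. s l \<le> i \<and> i \<le> e l" if "j < k" "s 0 \<le> i" "i \<le> e j" for i j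
    using that
  proof (induction j)
    case (Suc j)
    have "s (Suc j) \<le> e j"
      using assms Suc.prems(1) unfolding stanley_rows_def
      by (metis Suc_leI Suc_pred diff_Suc_1 le_add1 less_Suc_eq_le plus_1_eq_Suc k less_le_trans zero_less_one)
    show ?case
    proof (cases "i \<le> e j")
      case True
      then show ?thesis
        using Suc le_Suc_eq by auto
    next
      case False
      then show ?thesis
        using Suc.prems \<open>s (Suc j) \<le> e j\<close> by auto
    qed
  qed auto
  show ?thesis
  proof
    show "fst ` cells_of_rows k s e \<subseteq> {s 0..e (k - 1)}"
    proof
      fix i assume "i \<in> fst ` cells_of_rows k s e"
      then obtain j where j: "j < k" "s j \<le> i" "i \<le> e j"
        by (auto simp: cells_of_rows_def)
      have "s 0 \<le> s j" "e j \<le> e (k - 1)"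
        using stanley_rows_mono[OF assms, of 0 j] stanley_rows_mono[OF assms, of j "k - 1"] j k
        by auto
      with j show "i \<in> {s 0..e (k - 1)}"
        by auto
    qed
    show "{s 0..e (k - 1)} \<subseteq> fst ` cells_of_rows k s e"
    proof
      fix i assume "i \<in> {s 0..e (k - 1)}"
      then obtain l where "l \<le> k - 1" "s l \<le> i" "i \<le> e l"
        using cover[of "k - 1" i] k by auto
      then have "(i, int l) \<in> cells_of_rows k s e"
        using k by (auto simp: cells_of_rows_def)
      then show "i \<in> fst ` cells_of_rows k s e"
        by force
    qed
  qed
qed

lemma snd_cells_of_rows:
  assumes "stanley_rows k s e"
  shows "snd ` cells_of_rows k s e = int ` {..<k}"
proof
  show "snd ` cells_of_rows k s e \<subseteq> int ` {..<k}"
    by (auto simp: cells_of_rows_def)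
  show "int ` {..<k} \<subseteq> snd ` cells_of_rows k s e"
  proof
    fix m assume "m \<in> int ` {..<k}"
    then obtain j where "m = int j" "j < k" by auto
    then have "(s j, m) \<in> cells_of_rows k s e"
      using assms by (auto simp: cells_of_rows_def stanley_rows_def)
    then show "m \<in> snd ` cells_of_rows k s e"
      by force
  qed
qed

lemma col_cells_of_rows:
  assumes "stanley_rows k s e"
  shows "int (col (cells_of_rows k s e)) = e (k - 1) - s 0 + 1"
proof -
  have k: "k \<ge> 1"
    using assms by (simp add: stanley_rows_def)
  have "s 0 \<le> e 0"
    using assms by (simp add: stanley_rows_def)
  also have "e 0 \<le> e (k - 1)"
    using stanley_rows_mono[OF assms, of 0 "k - 1"] k by auto
  finally show ?thesis
    by (simp add: col_def fst_cells_of_rows[OF assms])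
qed

lemma row_cells_of_rows:
  assumes "stanley_rows k s e"
  shows "row (cells_of_rows k s e) = k"
  by (simp add: row_def snd_cells_of_rows[OF assms] card_image)

lemma first_row_cells_of_rows:
  assumes "stanley_rows k s e"
  shows "int (first_row (cells_of_rows k s e)) = e 0 - s 0 + 1"
proof -
  have "{i. (i, 0) \<in> cells_of_rows k s e} = {s 0..e 0}"
    using assms by (auto simp: cells_of_rows_def stanley_rows_def)
  moreover have "s 0 \<le> e 0"
    using assms by (simp add: stanley_rows_def)
  ultimately show ?thesis
    by (simp add: first_row_def)
qed

lemma equiv_translation: "equiv UNIV translation"
proof (rule equivI)
  show "refl translation"
    by (rule refl_onI) (auto simp: translation_def intro!: exI[of _ 0])
  show "sym translation"
  proof (rule symI)
    fix P Q assume "(P, Q) \<in> translation"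
    then obtain a b where "Q = (\<lambda>(i, j). (i + a, j + b)) ` P"
      by (auto simp: translation_def)
    then have "P = (\<lambda>(i, j). (i + (- a), j + (- b))) ` Q"
      by (simp add: image_image case_prod_beta)
    then show "(Q, P) \<in> translation"
      unfolding translation_def by blast
  qed
  show "trans translation"
  proof (rule transI)
    fix P Q R assume "(P, Q) \<in> translation" "(Q, R) \<in> translation"
    then obtain a b c d where "Q = (\<lambda>(i, j). (i + a, j + b)) ` P" "R = (\<lambda>(i, j). (i + c, j + d)) ` Q"
      by (auto simp: translation_def)
    then have "R = (\<lambda>(i, j). (i + (a + c), j + (b + d))) ` P"
      by (simp add: image_image case_prod_beta add.assoc)
    then show "(P, R) \<in> translation"
      unfolding translation_def by blast
  qed
qed auto

text \<open>The cardinalities in the generating function below are those of finite sets.\<close>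

lemma finite_stanley_classes: "finite (stanley_classes n k)"
proof -
  let ?B = "{0..int n} \<times> {0..int n}"
  have "stanley_classes n k \<subseteq> (\<lambda>P. translation `` {P}) ` Pow ?B"
  proof
    fix C assume "C \<in> stanley_classes n k"
    then obtain P where P: "stanley_polyomino P" "sper P = n" and C: "C = translation `` {P}"
      by (auto simp: stanley_classes_def elim!: quotientE)
    then obtain l s e where l: "stanley_rows l s e" "P = cells_of_rows l s e"
      by (auto simp: stanley_polyomino_def)
    define Q where "Q = (\<lambda>(i, j). (i + (- s 0), j + 0)) ` P"
    have "(P, Q) \<in> translation"
      unfolding translation_def Q_def by blast
    then have "C = translation `` {Q}"
      unfolding C by (rule equiv_class_eq[OF equiv_translation])
    moreover have "Q \<subseteq> ?B"
    proof -
      have n: "int n = e (l - 1) - s 0 + 1 + int l"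
        using P(2) col_cells_of_rows[OF l(1)] row_cells_of_rows[OF l(1)] l(2)
        by (simp add: sper_def flip: P(2))
      have "i - s 0 \<in> {0..int n} \<and> j \<in> {0..int n}" if "(i, j) \<in> P" for i j
      proof -
        have "i \<in> {s 0..e (l - 1)}" "j \<in> int ` {..<l}"
          using that l fst_cells_of_rows[OF l(1)] snd_cells_of_rows[OF l(1)]
          by (metis fst_conv image_eqI, metis snd_conv image_eqI)
        then show ?thesis
          using n by auto
      qed
      then show ?thesis
        by (auto simp: Q_def)
    qed
    ultimately show "C \<in> (\<lambda>P. translation `` {P}) ` Pow ?B"
      by blast
  qed
  then show ?thesis
    by (rule finite_subset) auto
qed

section \<open>Generating function\<close>

text \<open>
  Since \<open>s\<close> below has a pole at \<open>x = 0\<close>, all identities are stated in the ring \<open>\<real>((x))[[u]]\<close>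
  of formal power series in \<open>u\<close> over the field of formal Laurent series in \<open>x\<close>, i.e.\ in the
  type \<open>real fls fps\<close>. The series \<open>G\<close> is the sum of \<open>x\<^sup>n u\<^sup>k\<close> over all Stanley polyominoes, collected
  by monomials.
\<close>

definition stanley_gf :: "real fls fps" where
  "stanley_gf =
     Abs_fps (\<lambda>k. fps_to_fls (Abs_fps (\<lambda>n. of_nat (card (stanley_classes n k)))))"

text \<open>The square root is the power series with constant term \<open>root 2 1 = 1\<close>.\<close>

definition sqrt_discr :: "real fls" where
  "sqrt_discr =
     fps_to_fls (fps_radical root 2 (fps_X ^ 4 - 2 * fps_X ^ 3 - fps_X ^ 2 - 2 * fps_X + 1))"

lemma sqrt_discr_square:
  "sqrt_discr ^ 2 = fls_X ^ 4 - 2 * fls_X ^ 3 - fls_X ^ 2 - 2 * fls_X + 1"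
proof -
  let ?d = "fps_X ^ 4 - 2 * fps_X ^ 3 - fps_X ^ 2 - 2 * fps_X + 1 :: real fps"
  have "fps_nth ?d 0 = 1"
    by (simp add: fps_mult_nth_0)
  then have "fps_radical root 2 ?d ^ 2 = ?d"
    using power_radical[of ?d root 1] by (simp add: numeral_2_eq_2)
  then have "sqrt_discr ^ 2 = fps_to_fls ?d"
    unfolding sqrt_discr_def by (simp only: fps_to_fls_power[symmetric])
  then show ?thesis
    by (simp add: fls_times_fps_to_fls fps_to_fls_power)
qed

definition r_series :: "real fls" where
  "r_series = (1 + fls_X - fls_X ^ 2 - sqrt_discr) / (2 * fls_X)"

definition s_series :: "real fls" where
  "s_series = (1 + fls_X - fls_X ^ 2 + sqrt_discr) / (2 * fls_X)"

end

theory Submission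
  imports Defs
begin

text \<open>
  Write \<open>g(n, m)\<close> for the number of classes with semiperimeter \<open>n\<close> and \<open>m\<close> cells in the first row.
  Removing the leftmost cell of the first row, or the whole first row if the second one starts in the
  next column, gives \<open>g(n + 1, m + 1) = g(n, m) + (\<Sum>l>m. g(n - 1, l))\<close> for \<open>m \<ge> 1\<close>. Since
  \<open>x r\<^sup>2 - (1 + x - x\<^sup>2) r + 1 = 0\<close>, a geometric series shows that the coefficients of \<open>x\<^sup>2 (r x)\<^sup>m\<^sup>-\<^sup>1\<close>
  obey the same recursion, which determines them. The closed forms of \<open>G\<close> follow by summing over \<open>m\<close>.
  For the coefficients, put \<open>a = 1 + x - x\<^sup>2\<close>; then \<open>a r = 1 + (x / a\<^sup>2) (a r)\<^sup>2\<close>, so that powers of \<open>r\<close>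
  expand in terms of the ballot numbers, and the negative powers of \<open>a = 1 + x (1 - x)\<close> by two
  binomial expansions.
\<close>

section \<open>Counting Stanley polyominoes\<close>

text \<open>Sending \<open>f x\<close> to \<open>g x\<close> is well defined and injective, because
  both maps have the same fibres. This serves to replace translation classes by codes.\<close>

lemma card_image_eq_of_same_kernel:
  assumes "\<And>x y. x \<in> A \<Longrightarrow> y \<in> A \<Longrightarrow> f x = f y \<longleftrightarrow> g x = g y"
  shows "card (f ` A) = card (g ` A)"
proof -
  have g: "g (inv_into A f (f x)) = g x" if "x \<in> A" for x
    using that assms by (metis f_inv_into_f imageI inv_into_into)
  have "bij_betw (\<lambda>y. g (inv_into A f y)) (f ` A) (g ` A)"
    unfolding bij_betw_def
  proof
    show "inj_on (\<lambda>y. g (inv_into A f y)) (f ` A)"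
      by (rule inj_onI) (auto simp: g assms)
    show "(\<lambda>y. g (inv_into A f y)) ` f ` A = g ` A"
      by (auto simp: image_image g)
  qed
  then show ?thesis
    by (rule bij_betw_same_card)
qed

text \<open>
  Up to translation, a Stanley polyomino is given by the length \<open>m\<close> of its first row and the list of
  the pairs \<open>(s\<^sub>j - s\<^sub>j\<^sub>-\<^sub>1, e\<^sub>j - s\<^sub>j + 1)\<close> for \<open>1 \<le> j < k\<close>.
\<close>

fun stanley_code :: "nat \<Rightarrow> (nat \<times> nat) list \<Rightarrow> bool" where
  "stanley_code m [] \<longleftrightarrow> m \<ge> 1"
| "stanley_code m ((d, l) # xs) \<longleftrightarrow> 1 \<le> d \<and> d < m \<and> m < d + l \<and> stanley_code l xs"

text \<open>Each pair accounts for the \<open>d\<close> columns to the left of the next row and for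
  one row; the last row adds its own length and one more row.\<close>

fun code_sper :: "nat \<Rightarrow> (nat \<times> nat) list \<Rightarrow> nat" where
  "code_sper m [] = m + 1"
| "code_sper m ((d, l) # xs) = d + 1 + code_sper l xs"

definition codes :: "nat \<Rightarrow> nat \<Rightarrow> (nat \<times> nat) list set" where
  "codes n m = {xs. stanley_code m xs \<and> code_sper m xs = n}"

section \<open>Passing between row end points and codes\<close>

definition code_of_rows :: "nat \<Rightarrow> (nat \<Rightarrow> int) \<Rightarrow> (nat \<Rightarrow> int) \<Rightarrow> (nat \<times> nat) list" where
  "code_of_rows k s e =
     map (\<lambda>j. (nat (s (Suc j) - s j), nat (e (Suc j) - s (Suc j) + 1))) [0..<k - 1]"

lemma code_of_rows_1 [simp]: "code_of_rows (Suc 0) s e = []"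
  by (simp add: code_of_rows_def)

lemma code_of_rows_Suc_Suc:
  "code_of_rows (Suc (Suc k)) s e =
     (nat (s 1 - s 0), nat (e 1 - s 1 + 1)) # code_of_rows (Suc k) (s \<circ> Suc) (e \<circ> Suc)"
  by (rule nth_equalityI) (auto simp: code_of_rows_def nth_Cons simp del: upt_Suc split: nat.splits)

lemma length_code_of_rows [simp]: "length (code_of_rows k s e) = k - 1"
  by (simp add: code_of_rows_def)

lemma stanley_rows_1 [simp]: "stanley_rows (Suc 0) s e \<longleftrightarrow> s 0 \<le> e 0"
  by (auto simp: stanley_rows_def)

text \<open>Composing with \<open>Suc\<close> removes the bottom row, so inductions on the number of
  rows can follow the recursion of \<open>stanley_code\<close> on lists.\<close>

lemma stanley_rows_Suc_Suc:
  "stanley_rows (Suc (Suc k)) s e \<longleftrightarrow>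
     s 0 < s 1 \<and> s 1 \<le> e 0 \<and> e 0 < e 1 \<and> stanley_rows (Suc k) (s \<circ> Suc) (e \<circ> Suc)"
proof -
  have A: "(\<forall>j<Suc (Suc k). s j \<le> e j) \<longleftrightarrow> s 0 \<le> e 0 \<and> (\<forall>j<Suc k. s (Suc j) \<le> e (Suc j))"
    using All_less_Suc2 by auto
  have B: "(\<forall>j. 1 \<le> j \<and> j \<le> Suc l - 1 \<longrightarrow> P j) \<longleftrightarrow> (\<forall>i<l. P (Suc i))" for P l
    by (auto simp: less_eq_Suc_le) (metis Suc_le_D Suc_le_eq)
  show ?thesis
    unfolding stanley_rows_def A B All_less_Suc2 by auto
qed

text \<open>Induction by removing the bottom row. The right-hand side of the second claim is
  \<open>e k - s 0 + 1\<close> columns plus \<open>k + 1\<close> rows.\<close>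

lemma stanley_code_of_rows:
  assumes "stanley_rows (Suc k) s e"
  shows "stanley_code (nat (e 0 - s 0 + 1)) (code_of_rows (Suc k) s e)"
    "int (code_sper (nat (e 0 - s 0 + 1)) (code_of_rows (Suc k) s e)) = e k - s 0 + 2 + int k"
proof -
  have "stanley_code (nat (e 0 - s 0 + 1)) (code_of_rows (Suc k) s e) \<and>
    int (code_sper (nat (e 0 - s 0 + 1)) (code_of_rows (Suc k) s e)) = e k - s 0 + 2 + int k"
    using assms
  proof (induction k arbitrary: s e)
    case (Suc k)
    then show ?case
      using Suc.IH[of "s \<circ> Suc" "e \<circ> Suc"]
      by (auto simp: code_of_rows_Suc_Suc stanley_rows_Suc_Suc o_def)
  qed auto
  then show "stanley_code (nat (e 0 - s 0 + 1)) (code_of_rows (Suc k) s e)"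
    "int (code_sper (nat (e 0 - s 0 + 1)) (code_of_rows (Suc k) s e)) = e k - s 0 + 2 + int k"
    by auto
qed

text \<open>Rows that realise the tail of the code receive a new bottom row, placed as the head pair
  prescribes.\<close>

lemma stanley_code_realised:
  assumes "stanley_code m xs"
  shows "\<exists>k s e. stanley_rows (Suc k) s e \<and> code_of_rows (Suc k) s e = xs \<and> int m = e 0 - s 0 + 1"
  using assms
proof (induction m xs rule: stanley_code.induct)
  case (1 m)
  show ?case
    using 1 by (intro exI[of _ 0] exI[of _ "\<lambda>_. 1"] exI[of _ "\<lambda>_. int m"]) auto
next
  case (2 m d l xs)
  then obtain k s e where
    IH: "stanley_rows (Suc k) s e" "code_of_rows (Suc k) s e = xs" "int l = e 0 - s 0 + 1"
    by auto
  \<comment> \<open>The new row 0 starts \<open>d\<close> columns to the left of the old bottom row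
    and has \<open>m\<close> cells; \<open>case_nat\<close> moves the old rows up by one
    index.\<close>
  define s' e' where "s' = case_nat (s 0 - int d) s"
    and "e' = case_nat (s 0 - int d + int m - 1) e"
  have "s' \<circ> Suc = s" "e' \<circ> Suc = e"
    by (auto simp: s'_def e'_def)
  with IH 2 have "stanley_rows (Suc (Suc k)) s' e' \<and> code_of_rows (Suc (Suc k)) s' e' = (d, l) # xs
    \<and> int m = e' 0 - s' 0 + 1"
    unfolding code_of_rows_Suc_Suc stanley_rows_Suc_Suc by (auto simp: s'_def e'_def)
  then show ?case
    by blast
qed

section \<open>The code as a complete invariant under translation\<close>

lemma translate_cells_of_rows:
  "(\<lambda>(i, j). (i + a, j + 0)) ` cells_of_rows k s e = cells_of_rows k (\<lambda>j. s j + a) (\<lambda>j. e j + a)"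
proof -
  have "(i, int j) \<in> (\<lambda>(i, j). (i + a, j + 0)) ` cells_of_rows k s e"
    if "j < k" "s j + a \<le> i" "i \<le> e j + a" for i j
    using that by (intro image_eqI[of _ _ "(i - a, int j)"]) (auto simp: cells_of_rows_def)
  then show ?thesis
    by (auto simp: cells_of_rows_def)
qed

lemma cells_of_rows_cong:
  assumes "\<And>j. j < k \<Longrightarrow> s j = s' j \<and> e j = e' j"
  shows "cells_of_rows k s e = cells_of_rows k s' e'"
  using assms by (auto simp: cells_of_rows_def)

text \<open>The code records the offsets between consecutive rows and the later row lengths, so once
  the first rows have equal length only a horizontal shift is left free.\<close>

lemma rows_eq_of_code_eq:
  assumes "stanley_rows k s e" "stanley_rows k' s' e'"
    and "code_of_rows k s e = code_of_rows k' s' e'" "e 0 - s 0 = e' 0 - s' 0"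
  shows "k' = k" "\<And>j. j < k \<Longrightarrow> s' j = s j + (s' 0 - s 0) \<and> e' j = e j + (s' 0 - s 0)"
proof -
  have k: "k \<ge> 1" "k' \<ge> 1"
    using assms by (auto simp: stanley_rows_def)
  show k': "k' = k"
    using arg_cong[OF assms(3), of length] k by simp
  show "s' j = s j + (s' 0 - s 0) \<and> e' j = e j + (s' 0 - s 0)" if "j < k" for j
    using that
  proof (induction j)
    case 0
    then show ?case using assms(4) by simp
  next
    case (Suc j)
    have "code_of_rows k s e ! j = code_of_rows k s' e' ! j"
      using assms(3) k' by simp
    then have "nat (s (Suc j) - s j) = nat (s' (Suc j) - s' j)"
      "nat (e (Suc j) - s (Suc j) + 1) = nat (e' (Suc j) - s' (Suc j) + 1)"
      using Suc.prems by (auto simp: code_of_rows_def)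
    \<comment> \<open>Positive offsets and nonempty rows make the arguments of \<open>nat\<close>
      nonnegative, so the equations above hold over the integers.\<close>
    moreover have "s j < s (Suc j)" "s (Suc j) \<le> e (Suc j)" "s' j < s' (Suc j)" "s' (Suc j) \<le> e' (Suc j)"
      using assms(1,2) Suc.prems unfolding stanley_rows_def k'
      by (auto dest!: spec[of _ "Suc j"])
    ultimately show ?case
      using Suc by auto
  qed
qed

text \<open>The cell set yields the number of rows through \<open>row\<close>, and each row as a
  nonempty interval, which determines its end points.\<close>

lemma cells_of_rows_inject:
  assumes "stanley_rows k s e" "stanley_rows k' s' e'" "cells_of_rows k s e = cells_of_rows k' s' e'"
  shows "k' = k" "\<And>j. j < k \<Longrightarrow> s' j = s j \<and> e' j = e j"
proof -
  show k': "k' = k"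
    using assms by (metis row_cells_of_rows)
  show "s' j = s j \<and> e' j = e j" if "j < k" for j
  proof -
    have "{s j..e j} = {i. (i, int j) \<in> cells_of_rows k s e}"
      using that by (auto simp: cells_of_rows_def)
    also have "\<dots> = {s' j..e' j}"
      unfolding assms(3) using that k' by (auto simp: cells_of_rows_def)
    finally show ?thesis
      using assms(1) that by (auto simp: stanley_rows_def Icc_eq_Icc)
  qed
qed

lemma translation_cells_of_rows_iff:
  assumes "stanley_rows k s e" "stanley_rows k' s' e'"
  shows "(cells_of_rows k s e, cells_of_rows k' s' e') \<in> translation \<longleftrightarrow>
    code_of_rows k s e = code_of_rows k' s' e' \<and> e 0 - s 0 = e' 0 - s' 0"
    (is "?L \<longleftrightarrow> ?R")
proof
  assume R: ?R
  note * = rows_eq_of_code_eq[OF assms conjunct1[OF R] conjunct2[OF R]]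
  have "cells_of_rows k' s' e' = (\<lambda>(i, j). (i + (s' 0 - s 0), j + 0)) ` cells_of_rows k s e"
    unfolding translate_cells_of_rows *(1) by (rule cells_of_rows_cong) (use *(2) in blast)
  then show ?L
    unfolding translation_def by blast
next
  assume ?L
  then obtain a b where ab: "cells_of_rows k' s' e' = (\<lambda>(i, j). (i + a, j + b)) ` cells_of_rows k s e"
    unfolding translation_def by auto
  have k: "k \<ge> 1" "k' \<ge> 1"
    using assms by (auto simp: stanley_rows_def)
  have "snd ` cells_of_rows k' s' e' = (\<lambda>j. j + b) ` snd ` cells_of_rows k s e"
    unfolding ab by (simp add: image_image case_prod_beta)
  then have eq: "int ` {..<k'} = (\<lambda>j. j + b) ` int ` {..<k}"
    by (simp add: snd_cells_of_rows[OF assms(1)] snd_cells_of_rows[OF assms(2)])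
  \<comment> \<open>Both bottom rows have index 0. Index 0 of the second polyomino is hit by some
    row, so \<open>b \<le> 0\<close>; row 0 of the first one goes to index \<open>b\<close>, so
    \<open>b \<ge> 0\<close>.\<close>
  have "0 \<in> (\<lambda>j. j + b) ` int ` {..<k}"
    unfolding eq[symmetric] using k by force
  moreover have "b \<in> int ` {..<k'}"
    unfolding eq using k by force
  ultimately have "b = 0"
    by auto
  then have eq: "cells_of_rows k' s' e' = cells_of_rows k (\<lambda>j. s j + a) (\<lambda>j. e j + a)"
    using ab translate_cells_of_rows[of a k s e] by simp
  have "stanley_rows k (\<lambda>j. s j + a) (\<lambda>j. e j + a)"
    using assms(1) by (simp add: stanley_rows_def)
  note * = cells_of_rows_inject[OF this assms(2) eq[symmetric]]
  then show ?R
    using k by (auto simp: code_of_rows_def)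
qed

text \<open>On the set \<open>A\<close> below, the code is constant on translation classes,
  separates them, and takes every value in \<open>codes n m\<close>.\<close>

lemma card_stanley_classes: "card (stanley_classes n m) = card (codes n m)"
proof -
  define A where "A = {P. stanley_polyomino P \<and> sper P = n \<and> first_row P = m}"
  \<comment> \<open>A cell set fixes its end point functions only on existing rows, so one
    description is chosen. The choice is immaterial: two descriptions of one cell set are related by
    the trivial translation.\<close>
  define code where "code P = (SOME xs. \<exists>k s e. stanley_rows k s e \<and> P = cells_of_rows k s e \<and>
    xs = code_of_rows k s e)" for P
  have code: "code (cells_of_rows k s e) = code_of_rows k s e" if "stanley_rows k s e" for k s e
  proof -
    have "\<exists>k' s' e'. stanley_rows k' s' e' \<and> cells_of_rows k s e = cells_of_rows k' s' e' \<and>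
      code (cells_of_rows k s e) = code_of_rows k' s' e'"
      unfolding code_def by (rule someI_ex) (use that in blast)
    then obtain k' s' e' where *: "stanley_rows k' s' e'" "cells_of_rows k s e = cells_of_rows k' s' e'"
      "code (cells_of_rows k s e) = code_of_rows k' s' e'"
      by blast
    have "(cells_of_rows k s e, cells_of_rows k' s' e') \<in> translation"
      unfolding *(2) using equiv_translation by (auto simp: equiv_def refl_on_def)
    then show ?thesis
      using * translation_cells_of_rows_iff[OF that *(1)] by simp
  qed
  have A: "cells_of_rows (Suc k) s e \<in> A \<longleftrightarrow> m = nat (e 0 - s 0 + 1) \<and> n = code_sper m (code_of_rows (Suc k) s e)"
    if "stanley_rows (Suc k) s e" for k s e
  proof -
    have *: "int (first_row (cells_of_rows (Suc k) s e)) = e 0 - s 0 + 1"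
      by (rule first_row_cells_of_rows[OF that])
    have "int (sper (cells_of_rows (Suc k) s e)) =
      int (code_sper (nat (e 0 - s 0 + 1)) (code_of_rows (Suc k) s e))"
      unfolding stanley_code_of_rows[OF that] sper_def
      using col_cells_of_rows[OF that] row_cells_of_rows[OF that] by simp
    with * that show ?thesis
      by (auto simp: A_def stanley_polyomino_def simp flip: *)
  qed
  have A_cases: "\<exists>k s e. stanley_rows (Suc k) s e \<and> P = cells_of_rows (Suc k) s e" if P: "P \<in> A" for P
  proof -
    obtain k s e where *: "stanley_rows k s e" "P = cells_of_rows k s e"
      using P unfolding A_def stanley_polyomino_def by blast
    then obtain k' where "k = Suc k'"
      by (cases k) (auto simp: stanley_rows_def)
    with * show ?thesis
      by blast
  qed
  have "stanley_classes n m = (\<lambda>P. translation `` {P}) ` A"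
    unfolding stanley_classes_def A_def quotient_def by blast
  also have "card \<dots> = card (code ` A)"
  proof (rule card_image_eq_of_same_kernel)
    fix P Q assume PQ: "P \<in> A" "Q \<in> A"
    then obtain k s e k' s' e' where
      P: "stanley_rows (Suc k) s e" "P = cells_of_rows (Suc k) s e" and
      Q: "stanley_rows (Suc k') s' e'" "Q = cells_of_rows (Suc k') s' e'"
      using A_cases by meson
    have "translation `` {P} = translation `` {Q} \<longleftrightarrow> (P, Q) \<in> translation"
      by (rule eq_equiv_class_iff[OF equiv_translation]) simp_all
    \<comment> \<open>Both first rows have \<open>m\<close> cells, so the codes alone decide whether
      \<open>P\<close> and \<open>Q\<close> are translates.\<close>
    moreover have "e 0 - s 0 = e' 0 - s' 0"
    proof -
      have "m = nat (e 0 - s 0 + 1)" "m = nat (e' 0 - s' 0 + 1)"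
        using PQ P(2) Q(2) A[OF P(1)] A[OF Q(1)] by auto
      moreover have "s 0 \<le> e 0" "s' 0 \<le> e' 0"
        using P(1) Q(1) by (auto simp: stanley_rows_def)
      ultimately show ?thesis
        by linarith
    qed
    ultimately show "translation `` {P} = translation `` {Q} \<longleftrightarrow> code P = code Q"
      using P Q by (simp add: code translation_cells_of_rows_iff)
  qed
  also have "code ` A = codes n m"
  proof
    show "code ` A \<subseteq> codes n m"
    proof
      fix xs assume "xs \<in> code ` A"
      then obtain P where P: "P \<in> A" "xs = code P"
        by blast
      then obtain k s e where *: "stanley_rows (Suc k) s e" "P = cells_of_rows (Suc k) s e"
        using A_cases by meson
      then show "xs \<in> codes n m"
        using P A[OF *(1)] stanley_code_of_rows(1)[OF *(1)] code[OF *(1)] by (simp add: codes_def)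
    qed
    show "codes n m \<subseteq> code ` A"
    proof
      fix xs assume "xs \<in> codes n m"
      then have xs: "stanley_code m xs" "code_sper m xs = n"
        by (auto simp: codes_def)
      then obtain k s e where *: "stanley_rows (Suc k) s e" "code_of_rows (Suc k) s e = xs"
        "int m = e 0 - s 0 + 1"
        using stanley_code_realised by blast
      then have "cells_of_rows (Suc k) s e \<in> A"
        using A[OF *(1)] xs(2) by simp
      then show "xs \<in> code ` A"
        using code[OF *(1)] *(2) by (metis imageI)
    qed
  qed
  finally show ?thesis .
qed

section \<open>A recursion for the number of codes\<close>

lemma code_sper_ge: "stanley_code m xs \<Longrightarrow> m < code_sper m xs"
  by (induction m xs rule: stanley_code.induct) auto

lemma finite_codes: "finite (codes n m)"
proof -
  have "length xs \<le> n \<and> set xs \<subseteq> {..n} \<times> {..n}" if "stanley_code m xs" "code_sper m xs = n" for n m xs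
    using that
  proof (induction xs arbitrary: n m)
    case (Cons p xs)
    obtain d l where "p = (d, l)" by (cases p)
    with Cons.prems Cons.IH[of l] code_sper_ge[of l xs] show ?case
      by fastforce
  qed auto
  then have "codes n m \<subseteq> {xs. set xs \<subseteq> {..n} \<times> {..n} \<and> length xs \<le> n}"
    by (auto simp: codes_def)
  then show ?thesis
    by (rule finite_subset) (simp add: finite_lists_length_le)
qed

lemma codes_0_right [simp]: "codes n 0 = {}"
proof -
  have "\<not> stanley_code 0 xs" for xs
    by (cases "(0::nat, xs)" rule: stanley_code.cases) auto
  then show ?thesis
    by (simp add: codes_def)
qed

text \<open>A first row of one cell admits no offset \<open>d\<close> with \<open>1 \<le> d\<close>
  and \<open>d < 1\<close>, so there is no second row. This is the base case in
  \<open>m\<close>.\<close>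

lemma codes_1_right: "codes n (Suc 0) = (if n = 2 then {[]} else {})"
proof -
  have "xs = []" if "stanley_code (Suc 0) xs" for xs
    using that by (cases xs) auto
  then have "codes n (Suc 0) = {xs. xs = [] \<and> n = 2}"
    unfolding codes_def by fastforce
  then show ?thesis
    by simp
qed

text \<open>Lengthens the first row by one cell on the left. Its length is not stored in the list,
  so only the first offset changes.\<close>

fun widen :: "(nat \<times> nat) list \<Rightarrow> (nat \<times> nat) list" where
  "widen [] = []"
| "widen ((d, l) # xs) = (Suc d, l) # xs"

lemma inj_widen: "inj widen"
proof (rule injI)
  fix xs ys assume "widen xs = widen ys"
  then show "xs = ys"
    by (cases xs rule: widen.cases; cases ys rule: widen.cases) auto
qed

text \<open>If there is one row or the first offset is at least 2, the leftmost cell of the first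
  row can go. If the offset is 1, dropping that row loses one column and one row, and the next
  length \<open>l\<close> must exceed \<open>m\<close>.\<close>

lemma codes_Suc_Suc:
  assumes "m \<ge> 1"
  shows "codes (Suc n) (Suc m) =
    widen ` codes n m \<union> (\<Union>l\<in>{m<..n}. Cons (1, l) ` codes (n - 1) l)"
    (is "?L = ?A \<union> ?B")
proof
  show "?L \<subseteq> ?A \<union> ?B"
  proof
    fix xs assume xs: "xs \<in> ?L"
    show "xs \<in> ?A \<union> ?B"
    proof (cases xs)
      case Nil
      then have "[] \<in> codes n m"
        using xs assms by (auto simp: codes_def)
      then have "widen [] \<in> ?A"
        by (rule imageI)
      then show ?thesis
        using Nil by simp
    next
      case (Cons p ys)
      obtain d l where p: "p = (Suc d, l)"
        using xs Cons by (cases p, cases "fst p") (auto simp: codes_def)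
      show ?thesis
      proof (cases d)
        case 0
        \<comment> \<open>The rest \<open>ys\<close> has semiperimeter \<open>n - 1\<close>, which
          bounds \<open>l\<close> and keeps the index set of the union finite.\<close>
        have "l < code_sper l ys"
          using xs Cons p by (intro code_sper_ge) (auto simp: codes_def)
        then have "l \<in> {m<..n}" "ys \<in> codes (n - 1) l"
          using xs Cons p 0 by (auto simp: codes_def)
        then show ?thesis
          using Cons p 0 by auto
      next
        case (Suc d')
        then have "(d, l) # ys \<in> codes n m"
          using xs Cons p by (auto simp: codes_def)
        then have "widen ((d, l) # ys) \<in> ?A"
          by (rule imageI)
        then show ?thesis
          using Cons p by simp
      qed
    qed
  qed
  have "widen xs \<in> ?L" if "xs \<in> codes n m" for xs
    using that by (cases xs rule: widen.cases) (auto simp: codes_def)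
  moreover have "(1, l) # xs \<in> ?L" if "l \<in> {m<..n}" "xs \<in> codes (n - 1) l" for l xs
    using that assms by (auto simp: codes_def)
  ultimately show "?A \<union> ?B \<subseteq> ?L"
    by blast
qed

lemma card_codes_Suc_Suc:
  assumes "m \<ge> 1"
  shows "card (codes (Suc n) (Suc m)) = card (codes n m) + (\<Sum>l\<in>{m<..n}. card (codes (n - 1) l))"
proof -
  have "card (codes (Suc n) (Suc m)) =
    card (widen ` codes n m) + card (\<Union>l\<in>{m<..n}. Cons (1, l) ` codes (n - 1) l)"
    unfolding codes_Suc_Suc[OF assms]
  proof (rule card_Un_disjoint)
    \<comment> \<open>Offsets in a code are at least 1, hence at least 2 after widening.\<close>
    have "widen xs \<noteq> (1, l) # ys" if "xs \<in> codes n m" for xs ys l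
      using that by (cases xs rule: widen.cases) (auto simp: codes_def)
    then show "widen ` codes n m \<inter> (\<Union>l\<in>{m<..n}. Cons (1, l) ` codes (n - 1) l) = {}"
      by blast
  qed (auto simp: finite_codes)
  also have "card (widen ` codes n m) = card (codes n m)"
    using inj_widen by (intro card_image) (auto intro: inj_on_subset)
  also have "card (\<Union>l\<in>{m<..n}. Cons (1, l) ` codes (n - 1) l) = (\<Sum>l\<in>{m<..n}. card (codes (n - 1) l))"
    by (subst card_UN_disjoint) (auto simp: finite_codes card_image)
  finally show ?thesis .
qed

section \<open>The series of a given first row\<close>

text \<open>The numerator of \<open>r_series\<close> has constant term 0, so division by
  \<open>2 * fls_X\<close> is a shift and stays among power series.\<close>

definition r_fps :: "real fps" where
  "r_fps = fps_const (1 / 2) * fps_shift 1 (1 + fps_X - fps_X ^ 2 -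
     fps_radical root 2 (fps_X ^ 4 - 2 * fps_X ^ 3 - fps_X ^ 2 - 2 * fps_X + 1))"

lemma fps_to_fls_r_fps: "fps_to_fls r_fps = r_series"
  and r_fps_quadratic: "fps_X * r_fps ^ 2 + 1 = (1 + fps_X - fps_X ^ 2) * r_fps"
proof -
  define d :: "real fps" where "d = fps_X ^ 4 - 2 * fps_X ^ 3 - fps_X ^ 2 - 2 * fps_X + 1"
  define q where "q = fps_radical root 2 d"
  have "d $ 0 = 1"
    by (simp add: d_def fps_mult_nth_0)
  then have q: "q ^ 2 = d" "q $ 0 = 1"
    using power_radical[of d root 1] by (simp_all add: q_def numeral_2_eq_2)
  have r: "r_fps = fps_const (1 / 2) * fps_shift 1 (1 + fps_X - fps_X ^ 2 - q)"
    by (simp add: r_fps_def q_def d_def)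
  have "fps_X * fps_shift 1 (1 + fps_X - fps_X ^ 2 - q) = 1 + fps_X - fps_X ^ 2 - q"
    by (rule fps_ext) (simp add: q(2) fps_X_power_nth)
  then have *: "2 * fps_X * r_fps = 1 + fps_X - fps_X ^ 2 - q"
    unfolding r by (simp add: mult_ac fps_const_mult_apply_left flip: fps_numeral_fps_const)
       (simp add: fps_numeral_fps_const flip: mult.assoc)
  have "2 * fls_X * fps_to_fls r_fps = 1 + fls_X - fls_X ^ 2 - sqrt_discr"
    using arg_cong[OF *, of fps_to_fls]
    by (simp add: fls_times_fps_to_fls fps_to_fls_power sqrt_discr_def q_def d_def)
  then show "fps_to_fls r_fps = r_series"
    by (simp add: r_series_def eq_divide_eq mult_ac)
  have "q = 1 + fps_X - fps_X ^ 2 - 2 * fps_X * r_fps"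
    using * by simp
  then have "(1 + fps_X - fps_X ^ 2 - 2 * fps_X * r_fps) ^ 2 = d"
    using q(1) by simp
  \<comment> \<open>Since \<open>(1 + fps_X - fps_X ^ 2) ^ 2 - d = 4 * fps_X\<close>, expanding the
    square leaves this common factor, which can be cancelled.\<close>
  then have "4 * fps_X * (fps_X * r_fps ^ 2 + 1) = 4 * fps_X * ((1 + fps_X - fps_X ^ 2) * r_fps)"
    unfolding d_def by algebra
  then show "fps_X * r_fps ^ 2 + 1 = (1 + fps_X - fps_X ^ 2) * r_fps"
    by simp
qed

text \<open>Candidate for the counting series of a first row of \<open>m\<close> cells, meant for
  \<open>m \<ge> 1\<close>; \<open>card_codes_eq_row_gf\<close> confirms it.\<close>

definition row_gf :: "nat \<Rightarrow> real fps" where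
  "row_gf m = fps_X ^ 2 * (r_fps * fps_X) ^ (m - 1)"

lemma row_gf_rec:
  assumes "m \<ge> 1"
  shows "row_gf (Suc m) $ Suc n = row_gf m $ n + (\<Sum>l\<in>{m<..n}. row_gf l $ (n - 1))"
proof -
  define y where "y = r_fps * fps_X"
  \<comment> \<open>At least \<open>m\<close>, so that the geometric sum telescopes, and at least
    \<open>n\<close>, so that its tail, a multiple of \<open>fps_X ^ (N + 4)\<close>, misses degree
    \<open>n + 1\<close>.\<close>
  define N where "N = max m n"
  have y0: "y $ 0 = 0"
    by (simp add: y_def)
  define i where "i = inverse (1 - y)"
  have i: "i * (1 - y) = 1"
    unfolding i_def by (rule inverse_mult_eq_1) (simp add: y0)
  have geom: "(1 - y) * (\<Sum>l\<in>{m<..N}. row_gf l) = fps_X ^ 2 * (y ^ m - y ^ N)"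
  proof -
    have "{m<..N} = Suc ` {m..<N}"
      by (auto simp: image_Suc_atLeastLessThan)
    then have "(\<Sum>l\<in>{m<..N}. row_gf l) = sum row_gf (Suc ` {m..<N})"
      by (rule arg_cong)
    also have "\<dots> = (\<Sum>l=m..<N. fps_X ^ 2 * y ^ l)"
      by (subst sum.reindex) (simp_all add: row_gf_def y_def)
    finally have "(\<Sum>l\<in>{m<..N}. row_gf l) = (\<Sum>l=m..<N. fps_X ^ 2 * y ^ l)" .
    then have "(1 - y) * (\<Sum>l\<in>{m<..N}. row_gf l) = fps_X ^ 2 * ((1 - y) * (\<Sum>l=m..<N. y ^ l))"
      by (simp add: sum_distrib_left mult_ac)
    also have "(1 - y) * (\<Sum>l=m..<N. y ^ l) = (\<Sum>l=m..<N. y ^ l - y ^ Suc l)"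
      by (simp add: sum_distrib_left algebra_simps)
    also have "\<dots> = y ^ m - y ^ N"
      using sum_Suc_diff'[of m N "\<lambda>l. - (y ^ l)"] by (simp add: N_def)
    finally show ?thesis .
  qed
  \<comment> \<open>The quadratic equation in the form \<open>r = 1 + x^2 r / (1 - y)\<close>:
    multiplied by \<open>fps_X * row_gf m\<close>, its two summands become the two terms of the
    recursion.\<close>
  have yr: "(1 - y) * (r_fps - 1) = fps_X ^ 2 * r_fps"
    unfolding y_def using r_fps_quadratic by algebra
  obtain k where k: "m = Suc k"
    using assms by (cases m) auto
  have "(1 - y) * (row_gf (Suc m) - fps_X * row_gf m) =
    fps_X ^ 2 * y ^ k * fps_X * ((1 - y) * (r_fps - 1))"
    by (simp add: row_gf_def k y_def algebra_simps)
  also have "\<dots> = fps_X ^ 2 * (fps_X ^ 2 * y ^ m)"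
    unfolding yr by (simp add: k y_def algebra_simps power2_eq_square)
  also have "\<dots> = (1 - y) * (fps_X ^ 2 * (\<Sum>l\<in>{m<..N}. row_gf l)) + fps_X ^ 4 * y ^ N"
    unfolding mult.left_commute[of "1 - y"] geom
    by (simp add: y_def power_mult_distrib algebra_simps power2_eq_square power4_eq_xxxx)
  finally have "(1 - y) * (row_gf (Suc m) - fps_X * row_gf m) =
    (1 - y) * (fps_X ^ 2 * (\<Sum>l\<in>{m<..N}. row_gf l)) + fps_X ^ 4 * y ^ N" .
  then have "i * (1 - y) * (row_gf (Suc m) - fps_X * row_gf m) =
    i * (1 - y) * (fps_X ^ 2 * (\<Sum>l\<in>{m<..N}. row_gf l)) + fps_X ^ 4 * y ^ N * i"
    by (simp only: mult.assoc distrib_left mult.commute[of _ i])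
  then have "row_gf (Suc m) = fps_X * row_gf m + fps_X ^ 2 * (\<Sum>l\<in>{m<..N}. row_gf l) + fps_X ^ 4 * y ^ N * i"
    unfolding i by (simp add: algebra_simps)
  also have "fps_X ^ 4 * y ^ N * i = fps_X ^ (N + 4) * (r_fps ^ N * i)"
    by (simp add: y_def power_mult_distrib power_add mult_ac)
  finally have "row_gf (Suc m) $ Suc n = row_gf m $ n + (fps_X ^ 2 * (\<Sum>l\<in>{m<..N}. row_gf l)) $ Suc n"
    by (simp only: fps_add_nth fps_X_mult_nth fps_X_power_mult_nth) (simp add: N_def)
  \<comment> \<open>If \<open>m < n\<close> then \<open>N = n\<close>; otherwise both index ranges
    are empty.\<close>
  also have "(fps_X ^ 2 * (\<Sum>l\<in>{m<..N}. row_gf l)) $ Suc n = (\<Sum>l\<in>{m<..n}. row_gf l $ (n - 1))"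
  proof (cases "m < n")
    case True
    then show ?thesis
      by (simp only: fps_X_power_mult_nth) (simp add: N_def fps_sum_nth numeral_2_eq_2)
  qed (simp add: N_def)
  finally show ?thesis .
qed

section \<open>Expansion of the powers of r\<close>

text \<open>The convention for \<open>j = 0\<close> avoids the junk value \<open>0 / 0 = 0\<close> at \<open>j = p = 0\<close>.\<close>

definition ballot :: "nat \<Rightarrow> nat \<Rightarrow> real" where
  "ballot j p = (if j = 0 then 1 else real p / real (2 * j + p) * real ((2 * j + p) choose j))"

lemma ballot_0 [simp]: "ballot 0 p = 1" "ballot (Suc j) 0 = 0"
  by (simp_all add: ballot_def)

text \<open>Coefficient form of C^(p+1) = C^p + z C^(p+2) for the Catalan series C = 1 + z C^2. With
  \<open>n = 2 * j + p + 2\<close> the upper binomial entries are \<open>n + 1\<close>,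
  \<open>n\<close> and \<open>n\<close>, and all terms reduce to multiples of
  \<open>n choose j\<close>.\<close>

lemma ballot_Suc_Suc: "ballot (Suc j) (Suc p) = ballot (Suc j) p + ballot j (p + 2)"
proof -
  define n where "n = 2 * j + p + 2"
  have ballot: "ballot j (p + 2) = real (p + 2) / real n * real (n choose j)"
    by (cases "j = 0") (auto simp: ballot_def n_def ac_simps)
  have 1: "(real j + 1) * (real (n choose j) + real (n choose Suc j)) = (real n + 1) * real (n choose j)"
    using arg_cong[OF Suc_times_binomial[of j n], of real] by (simp add: algebra_simps)
  have "real (Suc n choose Suc j) = (real n + 1) * real (n choose j) / (real j + 1)"
    using 1 by (simp add: eq_divide_eq mult.commute)
  then have "ballot (Suc j) (Suc p) = (real p + 1) * real (n choose j) / (real j + 1)"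
    by (simp add: ballot_def n_def ac_simps divide_simps del: binomial_Suc_Suc)
  also have "\<dots> = (real p * (real j + real p + 2) + (real p + 2) * (real j + 1)) / (real n * (real j + 1)) *
    real (n choose j)"
  proof -
    have "real p * (real j + real p + 2) + (real p + 2) * (real j + 1) = (real p + 1) * real n"
      by (simp add: n_def algebra_simps)
    moreover have "real n \<noteq> 0"
      by (simp add: n_def)
    ultimately show ?thesis
      by simp
  qed
  also have "\<dots> = real p / real n * ((real j + real p + 2) * real (n choose j) / (real j + 1)) +
    (real p + 2) / real n * real (n choose j)"
  proof -
    have "(u * a + v * b) / (w * b) * c = u / w * (a * c / b) + v / w * c"
      if "b \<noteq> 0" "w \<noteq> 0" for a b c u v w :: real
      using that by (simp add: field_simps)
    then show ?thesis
      by (simp add: n_def)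
  qed
  also have "(real j + real p + 2) * real (n choose j) / (real j + 1) = real (n choose Suc j)"
  proof -
    have "real n = 2 * real j + real p + 2"
      by (simp add: n_def)
    then have "(real j + 1) * real (n choose Suc j) = (real j + real p + 2) * real (n choose j)"
      using 1 by algebra
    then show ?thesis
      by (simp add: divide_eq_eq mult.commute)
  qed
  also have "real p / real n * real (n choose Suc j) + (real p + 2) / real n * real (n choose j) =
    ballot (Suc j) p + ballot j (p + 2)"
    unfolding ballot by (simp add: ballot_def n_def ac_simps del: binomial_Suc_Suc)
  finally show ?thesis .
qed

text \<open>Convergence of the ballot expansion is phrased as agreement modulo every
  \<open>fps_X ^ n\<close>. Both \<open>r ^ p\<close> and the partial sums obey
  \<open>a * r ^ (p + 1) = r ^ p + fps_X * r ^ (p + 2)\<close>, the latter with one term fewer in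
  the last summand.\<close>

lemma quadratic_power_expansion:
  fixes r a :: "real fps"
  assumes "fps_X * r ^ 2 + 1 = a * r" and "a $ 0 \<noteq> 0"
  shows "fps_X ^ n dvd r ^ p - (\<Sum>j<n. fps_const (ballot j p) * fps_X ^ j * inverse a ^ (2 * j + p))"
proof (induction n arbitrary: p)
  case (Suc n)
  define i where "i = inverse a"
  have i: "a * i = 1"
    using assms(2) by (simp add: i_def inverse_mult_eq_1')
  have cancel: "a * (u * i ^ Suc q) = u * i ^ q" for u q
  proof -
    have "a * (u * i ^ Suc q) = (a * i) * (u * i ^ q)"
      by (simp add: mult_ac)
    then show ?thesis
      by (simp add: i)
  qed
  define S where "S n p = (\<Sum>j<n. fps_const (ballot j p) * fps_X ^ j * i ^ (2 * j + p))" for n p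
  have IH: "fps_X ^ n dvd r ^ p - S n p" for p
    using Suc.IH by (simp add: S_def i_def)
  \<comment> \<open>Inner induction on \<open>p\<close>: exponent \<open>p + 2\<close> is used only
    at order \<open>n\<close>, where the factor \<open>fps_X\<close> restores the missing order. At
    \<open>p = 0\<close> only the term \<open>j = 0\<close> survives.\<close>
  have "fps_X ^ Suc n dvd r ^ p - S (Suc n) p" for p
  proof (induction p)
    case 0
    then show ?case
      by (simp add: S_def sum.lessThan_Suc_shift del: sum.lessThan_Suc)
  next
    case (Suc p)
    have "a * S (Suc n) (Suc p) =
      (\<Sum>j<Suc n. fps_const (ballot j (Suc p)) * fps_X ^ j * i ^ (2 * j + p))"
      unfolding S_def sum_distrib_left add_Suc_right cancel ..
    also have "\<dots> = S (Suc n) p + fps_X * S n (p + 2)"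
    proof -
      have "fps_const (ballot (Suc j) (Suc p)) * fps_X ^ Suc j * i ^ (2 * Suc j + p) =
        fps_const (ballot (Suc j) p) * fps_X ^ Suc j * i ^ (2 * Suc j + p) +
        fps_X * (fps_const (ballot j (p + 2)) * fps_X ^ j * i ^ (2 * j + (p + 2)))" for j
      proof -
        have "2 * Suc j + p = 2 * j + (p + 2)"
          by simp
        then show ?thesis
          by (simp only: ballot_Suc_Suc fps_const_add[symmetric] power_Suc distrib_right distrib_left mult_ac)
      qed
      then show ?thesis
        by (simp only: S_def sum.lessThan_Suc_shift sum_distrib_left sum.distrib ballot_0 add.assoc)
    qed
    finally have S: "a * S (Suc n) (Suc p) = S (Suc n) p + fps_X * S n (p + 2)" .
    have "a * r ^ Suc p = r ^ p + fps_X * r ^ (p + 2)"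
    proof -
      have "a * r ^ Suc p = (a * r) * r ^ p"
        by (simp add: mult_ac)
      then show ?thesis
        by (simp add: power_add power2_eq_square algebra_simps flip: assms(1))
    qed
    with S have "a * (r ^ Suc p - S (Suc n) (Suc p)) =
        (r ^ p - S (Suc n) p) + fps_X * (r ^ (p + 2) - S n (p + 2))"
      by (simp only: right_diff_distrib add_diff_add)
    moreover have "fps_X ^ Suc n dvd (r ^ p - S (Suc n) p) + fps_X * (r ^ (p + 2) - S n (p + 2))"
      using Suc.IH IH[of "p + 2"] by (intro dvd_add) (auto intro: mult_dvd_mono)
    ultimately have "fps_X ^ Suc n dvd i * (a * (r ^ Suc p - S (Suc n) (Suc p)))"
      by (metis dvd_mult)
    also have "i * (a * (r ^ Suc p - S (Suc n) (Suc p))) = (a * i) * (r ^ Suc p - S (Suc n) (Suc p))"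
      by (simp only: mult_ac)
    finally show ?case
      by (simp add: i)
  qed
  then show ?case
    by (simp add: S_def i_def)
qed simp

lemma quadratic_power_nth:
  fixes r a :: "real fps"
  assumes "fps_X * r ^ 2 + 1 = a * r" and "a $ 0 \<noteq> 0"
  shows "(r ^ p) $ N = (\<Sum>j=0..N. ballot j p * (inverse a ^ (2 * j + p)) $ (N - j))"
proof -
  obtain f where "r ^ p - (\<Sum>j<Suc N. fps_const (ballot j p) * fps_X ^ j * inverse a ^ (2 * j + p)) =
    fps_X ^ Suc N * f"
    using quadratic_power_expansion[OF assms, of "Suc N" p] by (rule dvdE)
  then have "r ^ p = (\<Sum>j<Suc N. fps_const (ballot j p) * (fps_X ^ j * inverse a ^ (2 * j + p))) +
    fps_X ^ Suc N * f"
    by (simp add: algebra_simps)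
  then have "(r ^ p) $ N = (\<Sum>j<Suc N. ballot j p * (fps_X ^ j * inverse a ^ (2 * j + p)) $ N)"
    by (simp add: fps_X_power_mult_nth fps_sum_nth del: power_Suc sum.lessThan_Suc)
  also have "\<dots> = (\<Sum>j<Suc N. ballot j p * (inverse a ^ (2 * j + p)) $ (N - j))"
    by (intro sum.cong refl) (simp add: fps_X_power_mult_nth)
  finally show ?thesis
    by (simp only: lessThan_Suc_atMost atLeast0AtMost)
qed

text \<open>With \<open>t = fps_X * (1 - fps_X)\<close> the base is \<open>1 + t\<close>. The
  negative binomial series in \<open>t\<close> comes first, then the binomial expansion of each
  \<open>t ^ i\<close>.\<close>

lemma inverse_power_nth:
  assumes "q \<ge> 1"
  shows "(inverse (1 + fps_X - fps_X ^ 2 :: real fps) ^ q) $ M =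
    (- 1) ^ M * (\<Sum>b=0..M div 2. real ((q + M - b - 1) choose (M - b)) * real ((M - b) choose b))"
proof -
  define t :: "real fps" where "t = fps_X * (1 - fps_X)"
  have t0: "t $ 0 = 0"
    by (simp add: t_def)
  have tn: "(t ^ i) $ M = (- 1) ^ (M - i) * real (i choose (M - i))" if "i \<le> M" for i
  proof -
    have "(1 - fps_X :: real fps) ^ i = fps_binomial (of_nat i) oo (- fps_X)"
      using one_minus_const_fps_X_power[of "1::real" i] by simp
    also have "\<dots> $ (M - i) = (- 1) ^ (M - i) * real (i choose (M - i))"
      by (simp add: fps_compose_uminus' binomial_gbinomial)
    finally show ?thesis
      using that by (simp add: t_def power_mult_distrib fps_X_power_mult_nth)
  qed
  have "inverse (1 + fps_X - fps_X ^ 2 :: real fps) = inverse (1 + fps_X) oo t"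
    using t0 by (simp add: fps_inverse_compose fps_compose_add_distrib)
      (simp add: t_def algebra_simps power2_eq_square)
  then have "inverse (1 + fps_X - fps_X ^ 2 :: real fps) ^ q = inverse ((1 + fps_X) ^ q) oo t"
    using t0 by (simp add: fps_compose_power fps_inverse_power)
  also have "inverse ((1 + fps_X :: real fps) ^ q) = Abs_fps (\<lambda>i. (- 1) ^ i * real ((q + i - 1) choose i))"
    using one_minus_const_fps_X_neg_power'[of q "- 1 :: real"] assms
    by (simp add: mult.commute flip: fps_const_neg)
  also have "(\<dots> oo t) $ M = (\<Sum>i=0..M. (- 1) ^ i * real ((q + i - 1) choose i) *
      ((- 1) ^ (M - i) * real (i choose (M - i))))"
    unfolding fps_compose_nth by (intro sum.cong refl) (simp add: tn)
  also have "\<dots> = (\<Sum>i=0..M. (- 1) ^ M * (real ((q + i - 1) choose i) * real (i choose (M - i))))"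
  proof (intro sum.cong refl)
    fix i assume "i \<in> {0..M}"
    then have "(- 1 :: real) ^ M = (- 1) ^ i * (- 1) ^ (M - i)"
      by (simp flip: power_add)
    then show "(- 1) ^ i * real ((q + i - 1) choose i) * ((- 1) ^ (M - i) * real (i choose (M - i))) =
      (- 1) ^ M * (real ((q + i - 1) choose i) * real (i choose (M - i)))"
      by (simp only: mult_ac)
  qed
  \<comment> \<open>The new index \<open>b = M - i\<close> is the degree contributed by
    \<open>(1 - fps_X) ^ i\<close>; terms with \<open>2 * b > M\<close> vanish afterwards.\<close>
  also have "\<dots> = (\<Sum>b=0..M. (- 1) ^ M * (real ((q + (M - b) - 1) choose (M - b)) * real ((M - b) choose b)))"
    by (rule sum.reindex_bij_witness[of _ "\<lambda>b. M - b" "\<lambda>b. M - b"]) auto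
  also have "\<dots> = (\<Sum>b=0..M div 2. (- 1) ^ M * (real ((q + M - b - 1) choose (M - b)) * real ((M - b) choose b)))"
    by (rule sum.mono_neutral_cong_right) (auto simp: binomial_eq_0)
  finally show ?thesis
    by (simp add: sum_distrib_left)
qed

section \<open>The generating function\<close>

text \<open>Both sides agree for \<open>m = 1\<close> and for \<open>n = 0\<close> and satisfy the
  same recursion, which refers only to smaller \<open>n\<close>.\<close>

lemma card_codes_eq_row_gf:
  assumes "m \<ge> 1"
  shows "real (card (codes n m)) = row_gf m $ n"
  using assms
proof (induction n arbitrary: m rule: less_induct)
  case (less n m)
  show ?case
  proof (cases "m = 1")
    case True
    then show ?thesis
      by (simp add: codes_1_right row_gf_def fps_X_power_nth)
  next
    case False
    with less.prems obtain m' where m: "m = Suc m'" "m' \<ge> 1"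
      by (cases m) auto
    show ?thesis
    proof (cases n)
      case 0
      then have "codes n m = {}"
        using code_sper_ge by (fastforce simp: codes_def)
      then show ?thesis
        by (simp add: 0 row_gf_def)
    next
      case (Suc n')
      have "real (card (codes n m)) =
        real (card (codes n' m')) + (\<Sum>l\<in>{m'<..n'}. real (card (codes (n' - 1) l)))"
        using m(2) by (simp add: Suc m(1) card_codes_Suc_Suc)
      also have "\<dots> = row_gf m' $ n' + (\<Sum>l\<in>{m'<..n'}. row_gf l $ (n' - 1))"
        using less.IH m(2) by (simp add: Suc)
      also have "\<dots> = row_gf m $ n"
        unfolding Suc m(1) by (rule row_gf_rec[OF m(2), symmetric])
      finally show ?thesis .
    qed
  qed
qed

lemma stanley_gf_nth:
  assumes "k \<ge> 1"
  shows "stanley_gf $ k = fps_to_fls (row_gf k)"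
  using assms by (simp add: stanley_gf_def card_stanley_classes card_codes_eq_row_gf fps_eq_iff)

lemma stanley_gf_nth_0: "stanley_gf $ 0 = 0"
  by (simp add: stanley_gf_def card_stanley_classes flip: fps_zero_def)

lemma fps_to_fls_row_gf: "fps_to_fls (row_gf k) = fls_X ^ 2 * (r_series * fls_X) ^ (k - 1)"
  by (simp add: row_gf_def fls_times_fps_to_fls fps_to_fls_power fps_to_fls_r_fps)

lemma r_series_quadratic: "fls_X * r_series ^ 2 + 1 = (1 + fls_X - fls_X ^ 2) * r_series"
  using arg_cong[OF r_fps_quadratic, of fps_to_fls]
  by (simp add: fls_times_fps_to_fls fps_to_fls_power fps_to_fls_r_fps)

lemma sqrt_discr_eq: "sqrt_discr = 1 + fls_X - fls_X ^ 2 - 2 * fls_X * r_series"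
  by (simp add: r_series_def)

text \<open>This is the sum of the two roots of \<open>x z^2 - (1 + x - x^2) z + 1\<close>, cleared
  of its denominator.\<close>

lemma s_series_eq: "fls_X * s_series = 1 + fls_X - fls_X ^ 2 - fls_X * r_series"
proof -
  have "2 * (fls_X * s_series) = 1 + fls_X - fls_X ^ 2 + sqrt_discr"
    by (simp add: s_series_def)
  also have "\<dots> = 2 * (1 + fls_X - fls_X ^ 2 - fls_X * r_series)"
    by (simp add: sqrt_discr_eq)
  finally show ?thesis
    by (simp only: mult_cancel_left) simp
qed

text \<open>The coefficients in \<open>u\<close> form a geometric progression of ratio
  \<open>fls_X * r_series\<close> starting at \<open>u^1\<close>; this is its sum without
  division.\<close>

lemma stanley_gf_mult:
  "stanley_gf * (1 - fps_const fls_X * fps_const r_series * fps_X) = fps_const fls_X ^ 2 * fps_X"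
proof (rule fps_ext)
  fix n
  have "(stanley_gf * (1 - fps_const fls_X * fps_const r_series * fps_X)) $ n =
    (stanley_gf - fps_X * (fps_const (fls_X * r_series) * stanley_gf)) $ n"
    by (simp add: algebra_simps flip: fps_const_mult)
  also have "\<dots> = stanley_gf $ n - (if n = 0 then 0 else fls_X * r_series * stanley_gf $ (n - 1))"
    by simp
  also have "\<dots> = (if n = 1 then fls_X ^ 2 else 0)"
  proof (cases n)
    case 0
    then show ?thesis
      by (simp add: stanley_gf_nth_0)
  next
    case (Suc l)
    then show ?thesis
      by (cases l) (simp_all add: stanley_gf_nth stanley_gf_nth_0 fps_to_fls_row_gf mult_ac)
  qed
  also have "\<dots> = (fps_const fls_X ^ 2 * fps_X) $ n"
    by simp
  finally show "(stanley_gf * (1 - fps_const fls_X * fps_const r_series * fps_X)) $ n =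
    (fps_const fls_X ^ 2 * fps_X) $ n" .
qed

lemma stanley_gf_closed_form:
  defines "x \<equiv> fps_const fls_X" and "u \<equiv> fps_X" and "r \<equiv> fps_const r_series"
    and "s \<equiv> fps_const s_series" and "w \<equiv> fps_const sqrt_discr"
  shows "stanley_gf = x * u / (r * (s - u))"
    "stanley_gf = (x ^ 2 * u - x * u - u + 2 - w * u) * x ^ 2 * u /
       (2 * (u ^ 2 * x + x ^ 2 * u - x * u - u + 1))"
proof -
  define G where "G = stanley_gf"
  have G: "G * (1 - x * r * u) = x ^ 2 * u"
    using stanley_gf_mult by (simp only: G_def x_def r_def u_def)
  have r: "x * r ^ 2 + 1 = (1 + x - x ^ 2) * r"
    using arg_cong[OF r_series_quadratic, of fps_const]
    by (simp only: x_def r_def fps_const_mult fps_const_power flip: fps_const_1_eq_1)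
      (simp flip: fps_const_1_eq_1)
  have s: "x * s = 1 + x - x ^ 2 - x * r"
    using arg_cong[OF s_series_eq, of fps_const]
    by (simp flip: fps_const_mult fps_const_power fps_const_add fps_const_sub
        add: x_def r_def s_def)
  have w: "w = 1 + x - x ^ 2 - 2 * x * r"
    using arg_cong[OF sqrt_discr_eq, of fps_const]
    by (simp flip: fps_const_mult fps_const_power fps_const_add fps_const_sub
        add: x_def r_def w_def)
  have "x \<noteq> 0"
    by (simp add: x_def)
  have xrs: "x * (r * s) = 1"
  proof -
    have "x * (r * s) = r * (x * s)"
      by (simp only: mult_ac)
    also have "\<dots> = (1 + x - x ^ 2) * r - x * r ^ 2"
      unfolding s by (simp add: algebra_simps power2_eq_square)
    also have "\<dots> = 1"
      unfolding r[symmetric] by simp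
    finally show ?thesis .
  qed
  have "x * (G * (r * (s - u))) = G * (x * (r * s) - x * r * u)"
    by (simp add: algebra_simps)
  also have "\<dots> = x * (x * u)"
    unfolding xrs G by (simp add: power2_eq_square mult_ac)
  finally have *: "G * (r * (s - u)) = x * u"
    using \<open>x \<noteq> 0\<close> by simp
  \<comment> \<open>Division in the power series ring cancels once the divisor is known to be
    nonzero; here its product with \<open>G\<close> is nonzero.\<close>
  have "x * u \<noteq> 0"
    using \<open>x \<noteq> 0\<close> by (simp add: u_def)
  then have "r * (s - u) \<noteq> 0"
    unfolding *[symmetric] by auto
  then show "stanley_gf = x * u / (r * (s - u))"
    unfolding *[symmetric] G_def by simp
  define D where "D = u ^ 2 * x + x ^ 2 * u - x * u - u + 1"
  \<comment> \<open>\<open>D\<close> factors over the roots: \<open>x * r\<close> and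
    \<open>x * s\<close> have sum \<open>1 + x - x ^ 2\<close> and product \<open>x\<close>.\<close>
  have "(1 - x * r * u) * (1 - x * s * u) = 1 - (x * r + x * s) * u + x * (x * (r * s)) * u ^ 2"
    by (simp add: algebra_simps power2_eq_square)
  also have "\<dots> = D"
    unfolding xrs s D_def by (simp add: algebra_simps)
  finally have D: "D = (1 - x * r * u) * (1 - x * s * u)" ..
  \<comment> \<open>So the second closed form is \<open>x ^ 2 * u\<close> over
    \<open>1 - x * r * u\<close>, extended by \<open>2 * (1 - x * s * u)\<close>.\<close>
  have "x ^ 2 * u - x * u - u + 2 - w * u = 2 * (1 - x * s * u)"
    unfolding w s by (simp add: algebra_simps)
  then have "(x ^ 2 * u - x * u - u + 2 - w * u) * x ^ 2 * u = 2 * (1 - x * s * u) * (x ^ 2 * u)"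
    by (simp only: mult.assoc)
  also have "\<dots> = G * (2 * D)"
    unfolding D G[symmetric] by (simp only: mult_ac)
  finally have *: "(x ^ 2 * u - x * u - u + 2 - w * u) * x ^ 2 * u = G * (2 * D)" .
  have "D $ 0 = 1"
    by (simp add: D_def u_def)
  then have "2 * D \<noteq> 0"
    by auto
  then show "stanley_gf = (x ^ 2 * u - x * u - u + 2 - w * u) * x ^ 2 * u /
       (2 * (u ^ 2 * x + x ^ 2 * u - x * u - u + 1))"
    unfolding * D_def[symmetric] by (simp add: G_def)
qed

lemma stanley_gf_coeff:
  assumes "k \<ge> 2" "n \<ge> k + 1"
  shows "fls_nth (fps_nth stanley_gf k) (int n) =
    (\<Sum>j = 0..n - k - 1.
       real (k - 1) / real (2 * j + k - 1) * real ((2 * j + k - 1) choose j) *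
       (- 1) ^ (n - k - 1 - j) *
       (\<Sum>b = 0..(n - k - 1 - j) div 2.
          real ((n + j - b - 3) choose (n - k - 1 - j - b)) *
          real ((n - k - 1 - j - b) choose b)))"
proof -
  define a :: "real fps" where "a = 1 + fps_X - fps_X ^ 2"
  have "row_gf k = fps_X ^ (k + 1) * r_fps ^ (k - 1)"
    using assms(1) by (simp add: row_gf_def power_mult_distrib mult_ac flip: power_add)
  then have "fls_nth (fps_nth stanley_gf k) (int n) = (r_fps ^ (k - 1)) $ (n - k - 1)"
    using assms by (simp add: stanley_gf_nth fps_X_power_mult_nth del: power_Suc)
  also have "\<dots> = (\<Sum>j=0..n - k - 1. ballot j (k - 1) * (inverse a ^ (2 * j + (k - 1))) $ (n - k - 1 - j))"
    by (rule quadratic_power_nth) (use r_fps_quadratic in \<open>simp_all add: a_def\<close>)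
  also have "\<dots> = (\<Sum>j = 0..n - k - 1.
       real (k - 1) / real (2 * j + k - 1) * real ((2 * j + k - 1) choose j) *
       (- 1) ^ (n - k - 1 - j) *
       (\<Sum>b = 0..(n - k - 1 - j) div 2.
          real ((n + j - b - 3) choose (n - k - 1 - j - b)) *
          real ((n - k - 1 - j - b) choose b)))"
  proof (intro sum.cong refl)
    fix j assume j: "j \<in> {0..n - k - 1}"
    \<comment> \<open>As \<open>k - 1\<close> is positive, the quotient formula gives 1 at
      \<open>j = 0\<close> too.\<close>
    have "ballot j (k - 1) = real (k - 1) / real (2 * j + k - 1) * real ((2 * j + k - 1) choose j)"
      using assms(1) by (simp add: ballot_def)
    \<comment> \<open>The upper entry in \<open>inverse_power_nth\<close> for
      \<open>q = 2 * j + (k - 1)\<close> and \<open>M = n - k - 1 - j\<close>, where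
      \<open>q + M = n + j - 2\<close>.\<close>
    moreover have "(2 * j + (k - 1)) + (n - k - 1 - j) - b - 1 = n + j - b - 3" for b
      using assms j by simp
    moreover have "2 * j + (k - 1) \<ge> 1"
      using assms(1) by simp
    ultimately show "ballot j (k - 1) * (inverse a ^ (2 * j + (k - 1))) $ (n - k - 1 - j) =
      real (k - 1) / real (2 * j + k - 1) * real ((2 * j + k - 1) choose j) *
       (- 1) ^ (n - k - 1 - j) *
       (\<Sum>b = 0..(n - k - 1 - j) div 2.
          real ((n + j - b - 3) choose (n - k - 1 - j - b)) *
          real ((n - k - 1 - j - b) choose b))"
      unfolding a_def by (simp only: inverse_power_nth mult.assoc)
  qed
  finally show ?thesis .
qed

theorem theorem2p6:
  shows "(let x = fps_const fls_X; u = fps_X; r = fps_const r_series; s = fps_const s_series;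
              w = fps_const sqrt_discr
          in stanley_gf = x * u / (r * (s - u)) \<and>
             stanley_gf =
               (x ^ 2 * u - x * u - u + 2 - w * u) * x ^ 2 * u /
               (2 * (u ^ 2 * x + x ^ 2 * u - x * u - u + 1))) \<and>
         (\<forall>k\<ge>1. fps_nth stanley_gf k = fls_X ^ 2 * (r_series * fls_X) ^ (k - 1)) \<and>
         (\<forall>k\<ge>2. \<forall>n\<ge>k + 1. fls_nth (fps_nth stanley_gf k) (int n) =
            (\<Sum>j = 0..n - k - 1.
               real (k - 1) / real (2 * j + k - 1) * real ((2 * j + k - 1) choose j) *
               (- 1) ^ (n - k - 1 - j) *
               (\<Sum>b = 0..(n - k - 1 - j) div 2.
                  real ((n + j - b - 3) choose (n - k - 1 - j - b)) *
                  real ((n - k - 1 - j - b) choose b))))"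
  unfolding Let_def
  using stanley_gf_closed_form stanley_gf_nth fps_to_fls_row_gf stanley_gf_coeff by simp

end
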